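(* The following statements hold. (i) The set $B=\Omega_1\times\Omega_2\times\cdots\times\Omega_m\subset\mathcal H^m$ is prox-regular at every point $(\hat x_1,\hat x_2,\ldots,\hat x_m)\in B$ with $\mathcal G_d(\hat x_d)$ nonzero everywhere (in every entry) for all $d=1,\ldots,m$. (ii) The set $B^+=\Omega_0\times\Omega_1\times\cdots\times\Omega_m\subset\mathcal H^{m+1}$ is prox-regular at every point $(\hat x,\hat x_1,\ldots,\hat x_m)\in B^+$ with $\mathcal G_d(\hat x_d)$ nonzero everywhere for all $d=1,\ldots,m$. (iii) Suppose that the amplitude $\mathcal A$ is nonzero everywhere. Then the set $B_\chi=\chi\times\Omega_1\times\Omega_2\times\cdots\times\Omega_m\subset\mathcal H^{m+1}$ is prox-regular at every point $(\hat x,\hat x_1,\ldots,\hat x_m)\in B_\chi$ with $\mathcal G_d(\hat x_d)$ nonzero everywhere for all $d=1,\ldots,m$.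
   Context: Let $n,m\ge1$ be integers. Products, absolute values, squares, square roots, exponentials and equalities of $n\times n$ arrays are elementwise; $\mathrm j=\sqrt{-1}$; indices are $\xi=(\xi_1,\xi_2)$, $1\le\xi_1,\xi_2\le n$, and $w[\xi]$ is the entry of $w$ at $\xi$. Let $\mathcal I=\{XX,XY,XZ,YX,YY,YZ\}$ and $\mathcal H=(\mathbb C^{n\times n})^6$, with elements $x=(x_c)_{c\in\mathcal I}$, with Frobenius norm $\|x\|^2=\sum_{c\in\mathcal I}\sum_\xi|x_c[\xi]|^2$; $\mathcal H^p$ carries the norm whose square is the sum of the squared norms of the components. For a set $\Omega$, $P_\Omega(x)=\{w\in\Omega:\|x-w\|=\inf_{v\in\Omega}\|x-v\|\}$. The matrices $E_c$: for every index $\xi$ (sampling point of the lens aperture) let $(k_X,k_Y,k_Z)=(k_X[\xi],k_Y[\xi],k_Z[\xi])\in\mathbb R^3$ be a unit vector (the unit wave vector) with $1+k_Z\neq0$. The real $n\times n$ matrices $E_c$ are given entrywise by $E_{XX}=1-\frac{k_X^2}{1+k_Z}$, $E_{XY}=E_{YX}=-\frac{k_Xk_Y}{1+k_Z}$, $E_{YY}=1-\frac{k_Y^2}{1+k_Z}$, $E_{XZ}=-k_X$, $E_{YZ}=-k_Y$; they satisfy $\sum_{c\in\mathcal I}E_c^2=2$ in every entry. $\mathcal F$ is the (unitary) two-dimensional discrete Fourier transform on $\mathbb C^{n\times n}$; $\phi_d\in\mathbb R^{n\times n}$ and $r_d\in\mathbb R_+^{n\times n}$ ($d=1,\dots,m$)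 and the amplitude $\mathcal A\in\mathbb R_+^{n\times n}$ are given (entrywise nonnegative $r_d,\mathcal A$). Sets and functions: $\Omega_0=\{(E_c\cdot x)_{c\in\mathcal I}: x\in\mathbb C^{n\times n}\}$; $\Omega_d=\{x\in\mathcal H:\sum_{c\in\mathcal I}|\mathcal F(x_c\cdot e^{\mathrm j\phi_d})|^2=r_d\}$ for $d=1,\dots,m$; $\chi=\{(E_c\cdot\mathcal A\cdot e^{\mathrm j\Phi})_{c\in\mathcal I}:\Phi\in\mathbb R^{n\times n}\}$; $\mathcal G_d(x)=\sqrt{\sum_{c\in\mathcal I}|\mathcal F(x_c\cdot e^{\mathrm j\phi_d})|^2}\in\mathbb R_+^{n\times n}$. Definition (prox-regularity). A set $\Omega$ is prox-regular at a point $\hat x\in\Omega$ if its projector $P_\Omega$ is single-valued around $\hat x$, i.e. on some neighborhood of $\hat x$. *)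

theory Defs
  imports "HOL-Analysis.Analysis"
begin

datatype channel = XX | XY | XZ | YX | YY | YZ

lemma UNIV_channel: "(UNIV :: channel set) = {XX, XY, XZ, YX, YY, YZ}"
  using channel.exhaust by blast

instance channel :: finite
  by standard (simp add: UNIV_channel)

text \<open>
  An \<open>n \<times> n\<close> array is an element of \<open>'a^'n^'n\<close> with \<open>n = CARD('n)\<close>. The library's product
  on this type is elementwise, and the norms of the iterated vector type and of the product type
  are the Euclidean (Frobenius) ones.
\<close>

type_synonym ('a, 'n) array = "'a^'n^'n"
type_synonym 'n vfield = "((complex, 'n) array)^channel"

text \<open>
  The Fourier transform needs the indices to be numbered \<open>1, \<dots>, n\<close>; the numbering is the one
  induced by the linear order of the index type.
\<close>

definition index_pos :: "'n::{finite,linorder} \<Rightarrow> nat" where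
  "index_pos i = card {..i}"

lemma bij_betw_index_pos: "bij_betw (index_pos :: 'n::{finite,linorder} \<Rightarrow> nat) UNIV {1..CARD('n)}"
proof -
  have sm: "index_pos i < index_pos j" if "i < j" for i j :: 'n
    unfolding index_pos_def using that by (intro psubset_card_mono) auto
  then have inj: "inj (index_pos :: 'n \<Rightarrow> nat)"
    by (metis injI less_irrefl linorder_neqE)
  have sub: "index_pos ` (UNIV :: 'n set) \<subseteq> {1..CARD('n)}"
    by (auto simp: index_pos_def Suc_le_eq card_gt_0_iff intro!: card_mono)
  have "index_pos ` (UNIV :: 'n set) = {1..CARD('n)}"
    using sub inj by (intro card_subset_eq) (auto simp: card_image)
  with inj show ?thesis by (simp add: bij_betw_def)
qed

definition dft2 :: "(complex, 'n::{finite,linorder}) array \<Rightarrow> (complex, 'n) array" where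
  "dft2 w = (\<chi> \<eta>1 \<eta>2. (1 / of_nat CARD('n)) * (\<Sum>\<xi>1\<in>UNIV. \<Sum>\<xi>2\<in>UNIV. w $ \<xi>1 $ \<xi>2 *
     exp (- 2 * of_real pi * \<i> *
       of_nat ((index_pos \<xi>1 - 1) * (index_pos \<eta>1 - 1) + (index_pos \<xi>2 - 1) * (index_pos \<eta>2 - 1)) / of_nat CARD('n))))"

definition complex_array :: "(real, 'n::finite) array \<Rightarrow> (complex, 'n) array" where
  "complex_array a = (\<chi> \<xi>1 \<xi>2. complex_of_real (a $ \<xi>1 $ \<xi>2))"

definition phase :: "(real, 'n::finite) array \<Rightarrow> (complex, 'n) array" where
  "phase \<phi> = (\<chi> \<xi>1 \<xi>2. exp (\<i> * complex_of_real (\<phi> $ \<xi>1 $ \<xi>2)))"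

fun lensE :: "(real, 'n::finite) array \<Rightarrow> (real, 'n) array \<Rightarrow> (real, 'n) array \<Rightarrow>
    channel \<Rightarrow> (real, 'n) array" where
  "lensE kX kY kZ XX = (\<chi> \<xi>1 \<xi>2. 1 - (kX $ \<xi>1 $ \<xi>2)\<^sup>2 / (1 + kZ $ \<xi>1 $ \<xi>2))"
| "lensE kX kY kZ XY = (\<chi> \<xi>1 \<xi>2. - (kX $ \<xi>1 $ \<xi>2 * kY $ \<xi>1 $ \<xi>2) / (1 + kZ $ \<xi>1 $ \<xi>2))"
| "lensE kX kY kZ YX = (\<chi> \<xi>1 \<xi>2. - (kX $ \<xi>1 $ \<xi>2 * kY $ \<xi>1 $ \<xi>2) / (1 + kZ $ \<xi>1 $ \<xi>2))"
| "lensE kX kY kZ YY = (\<chi> \<xi>1 \<xi>2. 1 - (kY $ \<xi>1 $ \<xi>2)\<^sup>2 / (1 + kZ $ \<xi>1 $ \<xi>2))"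
| "lensE kX kY kZ XZ = (\<chi> \<xi>1 \<xi>2. - (kX $ \<xi>1 $ \<xi>2))"
| "lensE kX kY kZ YZ = (\<chi> \<xi>1 \<xi>2. - (kY $ \<xi>1 $ \<xi>2))"

lemma sum_lensE_squared:
  fixes kX kY kZ :: "(real, 'n::finite) array"
  assumes unit: "(kX $ \<xi>1 $ \<xi>2)\<^sup>2 + (kY $ \<xi>1 $ \<xi>2)\<^sup>2 + (kZ $ \<xi>1 $ \<xi>2)\<^sup>2 = 1"
    and nz: "1 + kZ $ \<xi>1 $ \<xi>2 \<noteq> 0"
  shows "(\<Sum>c\<in>UNIV. (lensE kX kY kZ c $ \<xi>1 $ \<xi>2)\<^sup>2) = 2"
proof -
  define a b z where "a = kX $ \<xi>1 $ \<xi>2" and "b = kY $ \<xi>1 $ \<xi>2" and "z = kZ $ \<xi>1 $ \<xi>2"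
  have nz': "1 + z \<noteq> 0" using nz by (simp add: z_def)
  have s: "a\<^sup>2 + b\<^sup>2 = (1 - z) * (1 + z)"
    using unit by (simp add: a_def b_def z_def algebra_simps power2_eq_square)
  then have q: "(a\<^sup>2 + b\<^sup>2) / (1 + z) = 1 - z" using nz' by simp
  have "(\<Sum>c\<in>UNIV. (lensE kX kY kZ c $ \<xi>1 $ \<xi>2)\<^sup>2) =
      (1 - a\<^sup>2 / (1 + z))\<^sup>2 + 2 * (a * b / (1 + z))\<^sup>2 + (1 - b\<^sup>2 / (1 + z))\<^sup>2 + a\<^sup>2 + b\<^sup>2"
    by (simp add: UNIV_channel a_def b_def z_def)
  also have "\<dots> = 2 - 2 * ((a\<^sup>2 + b\<^sup>2) / (1 + z)) + ((a\<^sup>2 + b\<^sup>2) / (1 + z))\<^sup>2 + (a\<^sup>2 + b\<^sup>2)"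
    by (simp add: power2_eq_square add_divide_distrib algebra_simps)
  also have "\<dots> = 2"
    unfolding q unfolding s by (simp add: power2_eq_square algebra_simps)
  finally show ?thesis .
qed

definition intensity :: "(real, 'n::{finite,linorder}) array \<Rightarrow> 'n vfield \<Rightarrow> (real, 'n) array" where
  "intensity \<phi> x = (\<chi> \<xi>1 \<xi>2. \<Sum>c\<in>UNIV. (cmod (dft2 (x $ c * phase \<phi>) $ \<xi>1 $ \<xi>2))\<^sup>2)"

definition G_amp :: "(real, 'n::{finite,linorder}) array \<Rightarrow> 'n vfield \<Rightarrow> (real, 'n) array" where
  "G_amp \<phi> x = (\<chi> \<xi>1 \<xi>2. sqrt (intensity \<phi> x $ \<xi>1 $ \<xi>2))"

definition Omega0 :: "(channel \<Rightarrow> (real, 'n::finite) array) \<Rightarrow> 'n vfield set" where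
  "Omega0 E = {(\<chi> c. complex_array (E c) * x) | x. True}"

definition Omega ::
    "(real, 'n::{finite,linorder}) array \<Rightarrow> (real, 'n) array \<Rightarrow> 'n vfield set" where
  "Omega \<phi> r = {x. intensity \<phi> x = r}"

definition Chi ::
    "(channel \<Rightarrow> (real, 'n::finite) array) \<Rightarrow> (real, 'n) array \<Rightarrow> 'n vfield set" where
  "Chi E A = {(\<chi> c. complex_array (E c) * complex_array A * phase \<Phi>) | \<Phi>. True}"

text \<open>The product \<open>\<Omega>\<^sub>1 \<times> \<dots> \<times> \<Omega>\<^sub>m\<close>, with the factors indexed by a finite type of cardinality \<open>m\<close>.\<close>

definition prod_Omega ::
    "('m::finite \<Rightarrow> (real, 'n::{finite,linorder}) array) \<Rightarrow> ('m \<Rightarrow> (real, 'n) array) \<Rightarrow>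
     ('n vfield^'m) set" where
  "prod_Omega \<phi> r = {x. \<forall>d. x $ d \<in> Omega (\<phi> d) (r d)}"

definition projector :: "'a::real_normed_vector set \<Rightarrow> 'a \<Rightarrow> 'a set" where
  "projector S x = {w \<in> S. norm (x - w) = (INF v\<in>S. norm (x - v))}"

definition prox_regular_at :: "'a::real_normed_vector set \<Rightarrow> 'a \<Rightarrow> bool" where
  "prox_regular_at S p \<longleftrightarrow>
     p \<in> S \<and> (\<exists>U. open U \<and> p \<in> U \<and> (\<forall>x\<in>U. \<exists>w. projector S x = {w}))"

end

theory Submission
  imports Defs
begin

text \<open>
  Apart from the linear subspace \<open>\<Omega>\<^sub>0\<close>, on which projection is unique everywhere, all the factors
  are built from one local model: the intersection of a linear subspace
  \<open>V\<close> with a sphere of positive radius \<open>\<rho>\<close> around the origin. All its points \<open>v\<close> have the same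
  norm, so a point of the model nearest to \<open>x\<close> is one that maximizes \<open>x \<bullet> v = y \<bullet> v\<close>, where \<open>y\<close>
  is the orthogonal projection of \<open>x\<close> to \<open>V\<close>. By the equality case of Cauchy-Schwarz the maximizer
  is unique, namely \<open>\<rho> y / \<parallel>y\<parallel>\<close>, as soon as \<open>y \<noteq> 0\<close>. This holds on the open half-space
  \<open>p \<bullet> x > 0\<close>, since \<open>p \<bullet> x = p \<bullet> y\<close>, and the half-space contains the given point \<open>p\<close>
  (\<open>prox_regular_at_subspace_Int_sphere\<close>).

  The squared norm of a vector of components is the sum of the squared norms of the components, so
  projecting to a product set means projecting every component, and products of prox-regular
  sets are prox-regular (\<open>prox_regular_at_Times\<close>, \<open>prox_regular_at_vec\<close>). Surjective linear
  isometries transport projectors (\<open>prox_regular_at_isometry_vimage\<close>).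

  Multiplication by a phase and the Fourier transform are isometries, the latter because the
  characters of a finite cyclic group are orthogonal (\<open>norm_dft2\<close>). After these isometries
  the condition that defines \<open>\<Omega>\<^sub>d\<close> decouples over the pixels, and at every pixel it says that a
  vector of six channels lies on a sphere of radius \<open>\<surd>r\<^sub>d\<close>; this radius is positive since
  \<open>\<G>\<^sub>d\<close> does not vanish. The set \<open>\<chi>\<close> decouples over the pixels as it stands: at each pixel it is
  the circle \<open>{A e\<^sup>i\<^sup>t E}\<close>, the intersection of the complex line through the nonzero vector
  \<open>E = (E\<^sub>c)\<^sub>c\<close> with a sphere of radius \<open>A \<parallel>E\<parallel>\<close>.
\<close>

section \<open>Prox-regularity of products, isometric preimages, subspaces and spheres\<close>

lemma mem_projector_iff:
  "w \<in> projector S x \<longleftrightarrow> w \<in> S \<and> (\<forall>v\<in>S. norm (x - w) \<le> norm (x - v))"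
proof (cases "w \<in> S")
  case True
  have bdd: "bdd_below ((\<lambda>v. norm (x - v)) ` S)"
    by (rule bdd_belowI2[of _ 0]) simp
  have "norm (x - w) = (INF v\<in>S. norm (x - v)) \<longleftrightarrow> (\<forall>v\<in>S. norm (x - w) \<le> norm (x - v))"
  proof
    assume "norm (x - w) = (INF v\<in>S. norm (x - v))"
    then show "\<forall>v\<in>S. norm (x - w) \<le> norm (x - v)"
      using cINF_lower[OF bdd] by auto
  next
    assume le: "\<forall>v\<in>S. norm (x - w) \<le> norm (x - v)"
    show "norm (x - w) = (INF v\<in>S. norm (x - v))"
    proof (rule antisym)
      show "norm (x - w) \<le> (INF v\<in>S. norm (x - v))"
        using True le by (intro cINF_greatest) auto
      show "(INF v\<in>S. norm (x - v)) \<le> norm (x - w)"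
        using cINF_lower[OF bdd True] .
    qed
  qed
  with True show ?thesis by (simp add: projector_def)
qed (simp add: projector_def)

lemma projector_Times: "projector (S \<times> T) (x, y) = projector S x \<times> projector T y"
proof (intro set_eqI iffI; clarsimp simp: mem_projector_iff norm_Pair)
  fix a b
  assume "a \<in> S" "b \<in> T" and le: "\<forall>s\<in>S. \<forall>t\<in>T.
    (norm (x - a))\<^sup>2 + (norm (y - b))\<^sup>2 \<le> (norm (x - s))\<^sup>2 + (norm (y - t))\<^sup>2"
  then have "(norm (x - a))\<^sup>2 \<le> (norm (x - s))\<^sup>2" if "s \<in> S" for s
    using that by fastforce
  moreover have "(norm (y - b))\<^sup>2 \<le> (norm (y - t))\<^sup>2" if "t \<in> T" for t
    using that le \<open>a \<in> S\<close> by fastforce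
  ultimately show "(\<forall>s\<in>S. norm (x - a) \<le> norm (x - s)) \<and> (\<forall>t\<in>T. norm (y - b) \<le> norm (y - t))"
    by (auto intro: power2_le_imp_le)
next
  fix a b s t
  assume "\<forall>v\<in>S. norm (x - a) \<le> norm (x - v)" "\<forall>v\<in>T. norm (y - b) \<le> norm (y - v)"
    and "s \<in> S" "t \<in> T"
  then show "(norm (x - a))\<^sup>2 + (norm (y - b))\<^sup>2 \<le> (norm (x - s))\<^sup>2 + (norm (y - t))\<^sup>2"
    by (intro add_mono power_mono) auto
qed

lemma prox_regular_at_Times:
  assumes "prox_regular_at S p" and "prox_regular_at T q"
  shows "prox_regular_at (S \<times> T) (p, q)"
proof -
  obtain U V where U: "open U" "p \<in> U" "\<forall>x\<in>U. \<exists>w. projector S x = {w}" "p \<in> S"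
    and V: "open V" "q \<in> V" "\<forall>x\<in>V. \<exists>w. projector T x = {w}" "q \<in> T"
    using assms unfolding prox_regular_at_def by metis
  have "\<exists>w. projector (S \<times> T) z = {w}" if "z \<in> U \<times> V" for z
    using that U(3) V(3) by (force simp: projector_Times)
  moreover have "open (U \<times> V)" using U(1) V(1) by (rule open_Times)
  ultimately show ?thesis
    unfolding prox_regular_at_def using U V by (intro conjI exI[of _ "U \<times> V"]) auto
qed

lemma norm_vec_squared: "(norm x)\<^sup>2 = (\<Sum>i\<in>UNIV. (norm (x $ i))\<^sup>2)"
  by (simp add: norm_vec_def L2_set_def sum_nonneg)

text \<open>
  If \<open>w\<close> is nearest to \<open>x\<close> in the product, then exchanging a single component of \<open>w\<close> cannot bring
  it closer to \<open>x\<close>, so that component is nearest in its factor.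
\<close>

lemma projector_vec:
  fixes S :: "'i::finite \<Rightarrow> 'a::real_normed_vector set"
  shows "projector {x. \<forall>i. x $ i \<in> S i} x = {w. \<forall>i. w $ i \<in> projector (S i) (x $ i)}"
proof (intro set_eqI iffI)
  fix w
  assume w: "w \<in> projector {x. \<forall>i. x $ i \<in> S i} x"
  then have wS: "\<And>i. w $ i \<in> S i" by (simp add: mem_projector_iff)
  have "norm (x $ i - w $ i) \<le> norm (x $ i - v)" if "v \<in> S i" for i v
  proof -
    define w' where "w' = (\<chi> j. if j = i then v else w $ j)"
    have "norm (x - w) \<le> norm (x - w')"
      using w wS that by (auto simp: mem_projector_iff w'_def)
    then have "(norm (x - w))\<^sup>2 \<le> (norm (x - w'))\<^sup>2" by (rule power_mono) simp
    then have "(norm (x $ i - w $ i))\<^sup>2 \<le> (norm (x $ i - v))\<^sup>2"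
      by (simp add: norm_vec_squared sum.remove[of UNIV i] w'_def)
    then show ?thesis by (rule power2_le_imp_le) simp
  qed
  with wS show "w \<in> {w. \<forall>i. w $ i \<in> projector (S i) (x $ i)}"
    by (simp add: mem_projector_iff)
next
  fix w
  assume w: "w \<in> {w. \<forall>i. w $ i \<in> projector (S i) (x $ i)}"
  have "norm (x - w) \<le> norm (x - v)" if "\<forall>i. v $ i \<in> S i" for v
  proof (rule power2_le_imp_le)
    show "(norm (x - w))\<^sup>2 \<le> (norm (x - v))\<^sup>2"
      unfolding norm_vec_squared using w that
      by (intro sum_mono power_mono) (auto simp: mem_projector_iff)
  qed simp
  with w show "w \<in> projector {x. \<forall>i. x $ i \<in> S i} x"
    by (simp add: mem_projector_iff)
qed

lemma prox_regular_at_vec: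
  fixes S :: "'i::finite \<Rightarrow> 'a::real_normed_vector set"
  assumes "\<And>i. prox_regular_at (S i) (p $ i)"
  shows "prox_regular_at {x. \<forall>i. x $ i \<in> S i} p"
proof -
  have "\<forall>i. \<exists>U. open U \<and> p $ i \<in> U \<and> (\<forall>x\<in>U. \<exists>w. projector (S i) x = {w})"
    using assms unfolding prox_regular_at_def by blast
  then obtain U where U: "\<And>i. open (U i)" "\<And>i. p $ i \<in> U i"
    and ex: "\<And>i x. x \<in> U i \<Longrightarrow> \<exists>w. projector (S i) x = {w}"
    by metis
  have "\<exists>w. projector {x. \<forall>i. x $ i \<in> S i} x = {w}" if x: "\<forall>i. x $ i \<in> U i" for x
  proof -
    have "\<forall>i. \<exists>w. projector (S i) (x $ i) = {w}" using ex x by blast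
    then obtain w where "\<And>i. projector (S i) (x $ i) = {w i}" by metis
    then have "projector {x. \<forall>i. x $ i \<in> S i} x = {\<chi> i. w i}"
      by (auto simp: projector_vec vec_eq_iff)
    then show ?thesis by blast
  qed
  moreover have "open {x. \<forall>i. x $ i \<in> U i}"
    using U(1) by (simp add: open_vector_box)
  moreover have "p $ i \<in> S i" for i
    using assms by (simp add: prox_regular_at_def)
  ultimately show ?thesis
    unfolding prox_regular_at_def using U(2)
    by (intro conjI exI[of _ "{x. \<forall>i. x $ i \<in> U i}"]) auto
qed

text \<open>
  A surjective linear isometry \<open>T\<close> identifies the nearest points in \<open>T -` S\<close> with those in \<open>S\<close>;
  being continuous, it also pulls back the neighbourhood on which they are unique.
\<close>

lemma prox_regular_at_isometry_vimage:
  fixes T :: "'a::euclidean_space \<Rightarrow> 'b::real_normed_vector"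
  assumes lin: "linear T" and iso: "\<And>x. norm (T x) = norm x" and surj: "surj T"
    and reg: "prox_regular_at S (T p)"
  shows "prox_regular_at (T -` S) p"
proof -
  obtain U where U: "open U" "T p \<in> U" "\<And>y. y \<in> U \<Longrightarrow> \<exists>w. projector S y = {w}" and "T p \<in> S"
    using reg unfolding prox_regular_at_def by blast
  have dist: "norm (T x - T y) = norm (x - y)" for x y
    using iso[of "x - y"] by (simp add: linear_diff[OF lin])
  then have inj: "inj T"
    by (metis injI eq_iff_diff_eq_0 norm_eq_zero)
  have proj: "projector (T -` S) x = T -` projector S (T x)" for x
  proof -
    have "(\<forall>v\<in>T -` S. norm (x - w) \<le> norm (x - v)) \<longleftrightarrow>
        (\<forall>u\<in>S. norm (T x - T w) \<le> norm (T x - u))" for w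
      unfolding dist by (metis dist surj surjD vimage_eq)
    then show ?thesis by (auto simp: mem_projector_iff)
  qed
  have "\<exists>w. projector (T -` S) x = {w}" if "T x \<in> U" for x
  proof -
    obtain y where "projector S (T x) = {y}" using U(3) \<open>T x \<in> U\<close> by blast
    moreover obtain w where "y = T w" using surj by blast
    ultimately have "projector (T -` S) x = {w}"
      using inj by (auto simp: proj dest: injD)
    then show ?thesis by blast
  qed
  moreover have "open (T -` U)"
    using U(1) linear_continuous_on[OF lin[unfolded linear_conv_bounded_linear], of UNIV]
    by (intro open_vimage) auto
  ultimately show ?thesis
    unfolding prox_regular_at_def using U(2) \<open>T p \<in> S\<close>
    by (intro conjI exI[of _ "T -` U"]) auto
qed

lemma prox_regular_at_subspace:
  fixes V :: "'a::euclidean_space set"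
  assumes "subspace V" and "p \<in> V"
  shows "prox_regular_at V p"
proof -
  have cl: "closed V" "convex V" "V \<noteq> {}"
    using assms by (auto intro: closed_subspace subspace_imp_convex)
  have "projector V x = {closest_point V x}" for x
  proof (intro set_eqI iffI; clarsimp simp: mem_projector_iff)
    fix w assume "w \<in> V" "\<forall>v\<in>V. norm (x - w) \<le> norm (x - v)"
    then show "w = closest_point V x"
      using cl by (intro closest_point_unique) (auto simp: dist_norm)
  next
    show "closest_point V x \<in> V \<and> (\<forall>v\<in>V. norm (x - closest_point V x) \<le> norm (x - v))"
      using closest_point_exists[OF cl(1,3), of x] by (auto simp: dist_norm)
  qed
  then show ?thesis
    unfolding prox_regular_at_def using assms(2) by (intro conjI exI[of _ UNIV]) auto
qed

text \<open>
  The choice \<open>V = UNIV\<close> gives spheres, and a complex line for \<open>V\<close> gives the circles from which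
  \<open>\<chi>\<close> is built.
\<close>

lemma prox_regular_at_subspace_Int_sphere:
  fixes V :: "'a::euclidean_space set"
  assumes V: "subspace V" and "\<rho> > 0" and p: "p \<in> V" "norm p = \<rho>"
  shows "prox_regular_at {w \<in> V. norm w = \<rho>} p"
proof -
  have "\<exists>w. projector {w \<in> V. norm w = \<rho>} x = {w}" if px: "0 < p \<bullet> x" for x
  proof -
    obtain y z where y: "y \<in> V" and z: "\<And>v. v \<in> V \<Longrightarrow> z \<bullet> v = 0" and x: "x = y + z"
      using orthogonal_subspace_decomp_exists[of V x] V
      by (metis orthogonal_def span_eq_iff)
    have "p \<bullet> y > 0" using px z[OF p(1)] by (simp add: x inner_add_right inner_commute)
    then have y0: "norm y > 0" by auto
    \<comment> \<open>the point of the sphere in the direction of the orthogonal projection of \<open>x\<close> to \<open>V\<close>\<close>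
    define w where "w = (\<rho> / norm y) *\<^sub>R y"
    have w: "w \<in> V" "norm w = \<rho>"
      using y V \<open>\<rho> > 0\<close> y0 by (auto simp: w_def subspace_scale)
    \<comment> \<open>since \<open>\<parallel>v\<parallel> = \<rho>\<close> is fixed, the distance from \<open>x\<close> to \<open>v\<close> depends on \<open>v\<close> only through \<open>y \<bullet> v\<close>\<close>
    have sq: "(norm (x - v))\<^sup>2 = (norm x)\<^sup>2 + \<rho>\<^sup>2 - 2 * (y \<bullet> v)" if "v \<in> V" "norm v = \<rho>" for v
    proof -
      have "x \<bullet> v = y \<bullet> v" using z[OF that(1)] by (simp add: x inner_add_left)
      moreover have "v \<bullet> v = \<rho>\<^sup>2" using that(2) by (simp flip: power2_norm_eq_inner)
      ultimately show ?thesis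
        by (simp add: power2_norm_eq_inner inner_diff_left inner_diff_right inner_commute[of v x])
    qed
    have yw: "y \<bullet> w = norm y * \<rho>"
      using y0 by (simp add: w_def power2_norm_eq_inner[symmetric] power2_eq_square)
    have "v = w" if v: "v \<in> V" "norm v = \<rho>" and "norm (x - v) \<le> norm (x - w)" for v
    proof -
      have "(norm (x - v))\<^sup>2 \<le> (norm (x - w))\<^sup>2" using that(3) by (rule power_mono) simp
      then have "y \<bullet> v \<ge> norm y * norm v"
        using v by (simp add: sq[OF v] sq[OF w] yw)
      then have "y \<bullet> v = norm y * norm v" using norm_cauchy_schwarz[of y v] by simp
      then have "norm y *\<^sub>R v = \<rho> *\<^sub>R y"
        using norm_cauchy_schwarz_eq[of y v] v(2) by simp
      then have "(1 / norm y) *\<^sub>R (norm y *\<^sub>R v) = (1 / norm y) *\<^sub>R (\<rho> *\<^sub>R y)" by simp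
      then show "v = w" using y0 by (simp add: w_def)
    qed
    moreover have "norm (x - w) \<le> norm (x - v)" if v: "v \<in> V" "norm v = \<rho>" for v
    proof (rule power2_le_imp_le)
      show "(norm (x - w))\<^sup>2 \<le> (norm (x - v))\<^sup>2"
        using norm_cauchy_schwarz[of y v] v(2) by (simp add: sq[OF v] sq[OF w] yw)
    qed simp
    ultimately have "projector {w \<in> V. norm w = \<rho>} x = {w}"
      using w by (auto simp: mem_projector_iff)
    then show ?thesis by blast
  qed
  moreover have "p \<bullet> p > 0" using p(2) \<open>\<rho> > 0\<close> by auto
  ultimately show ?thesis
    unfolding prox_regular_at_def using p
    by (intro conjI exI[of _ "{x. 0 < p \<bullet> x}"]) (auto simp: open_halfspace_gt)
qed

section \<open>Unitarity of the Fourier transform\<close>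

text \<open>
  Parseval's identity for an arbitrary orthogonal kernel: in the expanded square only the
  diagonal terms survive the summation over \<open>b\<close>.
\<close>

lemma sum_cmod_squared_orthogonal_kernel:
  fixes K :: "'a::finite \<Rightarrow> 'b::finite \<Rightarrow> complex"
  assumes orth: "\<And>a a'. (\<Sum>b\<in>UNIV. K a b * cnj (K a' b)) = (if a = a' then of_real N else 0)"
  shows "(\<Sum>b\<in>UNIV. (cmod (\<Sum>a\<in>UNIV. w a * K a b))\<^sup>2) = N * (\<Sum>a\<in>UNIV. (cmod (w a))\<^sup>2)"
proof -
  have "complex_of_real (\<Sum>b\<in>UNIV. (cmod (\<Sum>a\<in>UNIV. w a * K a b))\<^sup>2)
      = (\<Sum>b\<in>UNIV. \<Sum>a\<in>UNIV. \<Sum>a'\<in>UNIV. w a * cnj (w a') * (K a b * cnj (K a' b)))"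
    by (simp only: of_real_sum complex_norm_square cnj_sum sum_product complex_cnj_mult mult_ac)
  also have "\<dots> = (\<Sum>a\<in>UNIV. \<Sum>a'\<in>UNIV. \<Sum>b\<in>UNIV. w a * cnj (w a') * (K a b * cnj (K a' b)))"
    by (subst sum.swap) (rule sum.cong[OF refl], rule sum.swap)
  also have "\<dots> = (\<Sum>a\<in>UNIV. \<Sum>a'\<in>UNIV. w a * cnj (w a') * (if a = a' then of_real N else 0))"
    by (simp only: sum_distrib_left[symmetric] orth)
  also have "\<dots> = (\<Sum>a\<in>UNIV. w a * cnj (w a) * of_real N)"
    by (simp add: if_distrib[of "\<lambda>t. _ * t"] cong: if_cong)
  also have "\<dots> = complex_of_real (N * (\<Sum>a\<in>UNIV. (cmod (w a))\<^sup>2))"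
    by (simp add: complex_norm_square sum_distrib_left mult_ac del: of_real_power)
  finally show ?thesis by (simp only: of_real_eq_iff)
qed

text \<open>
  The one-dimensional kernel without the factor \<open>1 / \<surd>n\<close>. Positions are numbered from 1,
  and the truncated subtraction turns them into frequencies \<open>0, \<dots>, n - 1\<close>.
\<close>

definition fourier_kernel :: "'n::{finite,linorder} \<Rightarrow> 'n \<Rightarrow> complex" where
  "fourier_kernel \<xi> \<eta> =
     exp (- 2 * of_real pi * \<i> * of_nat ((index_pos \<xi> - 1) * (index_pos \<eta> - 1)) / of_nat CARD('n))"

lemma bij_betw_index_pos_minus_1:
  "bij_betw (\<lambda>i. index_pos i - 1) (UNIV :: 'n::{finite,linorder} set) {..<CARD('n)}"
proof -
  have "bij_betw (\<lambda>k. k - 1) {1..CARD('n)} {..<CARD('n)}"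
    by (rule bij_betw_byWitness[where f' = Suc]) auto
  then show ?thesis
    using bij_betw_trans[OF bij_betw_index_pos] by (simp add: comp_def)
qed

text \<open>
  Orthogonality of characters: the sum is a geometric series whose ratio \<open>z\<close> is an \<open>n\<close>-th root of
  unity, and \<open>z = 1\<close> exactly if \<open>\<xi> = \<xi>'\<close>.
\<close>

lemma sum_fourier_kernel:
  fixes \<xi> \<xi>' :: "'n::{finite,linorder}"
  shows "(\<Sum>\<eta>\<in>UNIV. fourier_kernel \<xi> \<eta> * cnj (fourier_kernel \<xi>' \<eta>))
    = (if \<xi> = \<xi>' then of_real CARD('n) else 0)"
proof -
  let ?n = "CARD('n)"
  define a b where "a = index_pos \<xi> - 1" and "b = index_pos \<xi>' - 1"
  have n: "?n > 0" by simp
  have ab: "a < ?n" "b < ?n"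
    using bij_betw_apply[OF bij_betw_index_pos_minus_1] by (auto simp: a_def b_def)
  define z where "z = exp (2 * of_real pi * \<i> * of_int (int b - int a) / of_nat ?n)"
  have "fourier_kernel \<xi> \<eta> * cnj (fourier_kernel \<xi>' \<eta>) = z ^ (index_pos \<eta> - 1)" for \<eta>
  proof -
    define k where "k = index_pos \<eta> - 1"
    have "fourier_kernel \<xi> \<eta> * cnj (fourier_kernel \<xi>' \<eta>)
        = exp (- 2 * of_real pi * \<i> * of_nat (a * k) / of_nat ?n) *
          cnj (exp (- 2 * of_real pi * \<i> * of_nat (b * k) / of_nat ?n))"
      by (simp only: fourier_kernel_def a_def b_def k_def)
    also have "\<dots> = exp (of_nat k * (2 * of_real pi * \<i> * of_int (int b - int a) / of_nat ?n))"
      unfolding exp_cnj mult_exp_exp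
      by (rule arg_cong[where f = exp]) (simp add: field_simps)
    also have "\<dots> = z ^ k" by (simp only: z_def exp_of_nat_mult)
    finally show ?thesis by (simp only: k_def)
  qed
  then have "(\<Sum>\<eta>\<in>UNIV. fourier_kernel \<xi> \<eta> * cnj (fourier_kernel \<xi>' \<eta>)) = (\<Sum>j<?n. z ^ j)"
    using sum.reindex_bij_betw[OF bij_betw_index_pos_minus_1, of "\<lambda>j. z ^ j"] by simp
  also have "\<dots> = (if \<xi> = \<xi>' then of_real ?n else 0)"
  proof (cases "\<xi> = \<xi>'")
    case True
    then show ?thesis by (simp add: z_def a_def b_def)
  next
    case False
    have "a \<noteq> b"
      using False bij_betw_index_pos_minus_1[where 'n = 'n]
      by (auto simp: a_def b_def bij_betw_def dest: injD)
    have "z \<noteq> 1"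
    proof
      assume "z = 1"
      then obtain k :: int where "2 * pi * real_of_int (int b - int a) / real ?n = of_int (2 * k) * pi"
        unfolding z_def exp_eq_1 by (auto simp: Im_divide_of_nat)
      then have "2 * pi * (real_of_int (int b - int a) / real ?n) = 2 * pi * of_int k"
        by (simp add: mult_ac)
      then have "real_of_int (int b - int a) / real ?n = of_int k"
        unfolding mult_cancel_left by simp
      then have "real_of_int (int b - int a) = real_of_int (k * int ?n)"
        using n by (simp add: field_simps)
      then have "int b - int a = k * int ?n" by (simp only: of_int_eq_iff)
      then have "int ?n dvd int b - int a" by simp
      then have "\<bar>int ?n\<bar> \<le> \<bar>int b - int a\<bar>"
        using \<open>a \<noteq> b\<close> by (intro dvd_imp_le_int) auto
      then show False using ab by linarith
    qed
    moreover have "z ^ ?n = 1"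
    proof -
      have "z ^ ?n = exp (of_nat ?n * (2 * of_real pi * \<i> * of_int (int b - int a) / of_nat ?n))"
        by (simp only: z_def exp_of_nat_mult)
      also have "\<dots> = exp (2 * of_int (int b - int a) * of_real pi * \<i>)" using n by (simp add: mult_ac)
      also have "\<dots> = 1" unfolding exp_eq_1 by (auto intro!: exI[of _ "int b - int a"])
      finally show ?thesis .
    qed
    ultimately show ?thesis using False by (simp add: geometric_sum)
  qed
  finally show ?thesis .
qed

text \<open>
  The exponential of a sum factors, so the two-dimensional kernel is a product of one-dimensional
  ones. Writing the double sum as one over pairs makes Parseval's identity applicable at once.
\<close>

lemma dft2_eq_sum_fourier_kernel:
  fixes w :: "(complex, 'n::{finite,linorder}) array"
  shows "dft2 w $ \<eta>1 $ \<eta>2 = 1 / of_nat CARD('n) *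
    (\<Sum>\<xi>\<in>UNIV. w $ fst \<xi> $ snd \<xi> * (fourier_kernel (fst \<xi>) \<eta>1 * fourier_kernel (snd \<xi>) \<eta>2))"
proof -
  have "exp (- 2 * of_real pi * \<i> *
       of_nat ((index_pos \<xi>1 - 1) * (index_pos \<eta>1 - 1) + (index_pos \<xi>2 - 1) * (index_pos \<eta>2 - 1)) / of_nat CARD('n))
     = fourier_kernel \<xi>1 \<eta>1 * fourier_kernel \<xi>2 \<eta>2" for \<xi>1 \<xi>2 :: 'n
    unfolding fourier_kernel_def mult_exp_exp
    by (simp only: of_nat_add distrib_left add_divide_distrib)
  then show ?thesis
    unfolding dft2_def
    by (simp add: sum.cartesian_product UNIV_Times_UNIV[symmetric] case_prod_unfold del: UNIV_Times_UNIV)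
qed

lemma norm_dft2: "norm (dft2 w) = norm w"
  for w :: "(complex, 'n::{finite,linorder}) array"
proof (rule power2_eq_imp_eq)
  let ?n = "real CARD('n)"
  let ?K = "\<lambda>\<xi> \<eta> :: 'n \<times> 'n. fourier_kernel (fst \<xi>) (fst \<eta>) * fourier_kernel (snd \<xi>) (snd \<eta>)"
  have sq: "(norm v)\<^sup>2 = (\<Sum>\<xi>\<in>UNIV. (cmod (v $ fst \<xi> $ snd \<xi>))\<^sup>2)" for v :: "(complex, 'n) array"
    by (simp add: norm_vec_squared sum.cartesian_product UNIV_Times_UNIV[symmetric] case_prod_unfold
        del: UNIV_Times_UNIV)
  have orth: "(\<Sum>\<eta>\<in>UNIV. ?K \<xi> \<eta> * cnj (?K \<xi>' \<eta>)) = (if \<xi> = \<xi>' then of_real (?n\<^sup>2) else 0)"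
    for \<xi> \<xi>' :: "'n \<times> 'n"
  proof -
    have "(\<Sum>\<eta>\<in>UNIV. ?K \<xi> \<eta> * cnj (?K \<xi>' \<eta>))
        = (\<Sum>\<eta>\<in>UNIV. fourier_kernel (fst \<xi>) \<eta> * cnj (fourier_kernel (fst \<xi>') \<eta>)) *
          (\<Sum>\<eta>\<in>UNIV. fourier_kernel (snd \<xi>) \<eta> * cnj (fourier_kernel (snd \<xi>') \<eta>))"
      unfolding sum_product sum.cartesian_product UNIV_Times_UNIV[symmetric]
      by (rule sum.cong) (auto simp: mult_ac)
    then show ?thesis
      by (auto simp: sum_fourier_kernel prod_eq_iff power2_eq_square)
  qed
  have "(cmod (dft2 w $ fst \<eta> $ snd \<eta>))\<^sup>2
      = (cmod (\<Sum>\<xi>\<in>UNIV. w $ fst \<xi> $ snd \<xi> * ?K \<xi> \<eta>))\<^sup>2 / ?n\<^sup>2" for \<eta>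
    unfolding dft2_eq_sum_fourier_kernel norm_mult power_mult_distrib
    by (simp add: norm_divide power_divide)
  then have "(norm (dft2 w))\<^sup>2 = (\<Sum>\<eta>\<in>UNIV. (cmod (\<Sum>\<xi>\<in>UNIV. w $ fst \<xi> $ snd \<xi> * ?K \<xi> \<eta>))\<^sup>2) / ?n\<^sup>2"
    by (simp only: sq sum_divide_distrib)
  also have "\<dots> = (norm w)\<^sup>2"
    by (subst sum_cmod_squared_orthogonal_kernel[OF orth]) (simp add: sq)
  finally show "(norm (dft2 w))\<^sup>2 = (norm w)\<^sup>2" .
qed simp_all

lemma linear_dft2: "linear (dft2 :: (complex, 'n::{finite,linorder}) array \<Rightarrow> _)"
  by (rule linearI) (simp_all add: vec_eq_iff dft2_eq_sum_fourier_kernel scaleR_conv_of_real[where 'a = complex] distrib_left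
      distrib_right sum.distrib sum_distrib_left mult_ac)

section \<open>The constraint sets, pixel by pixel\<close>

text \<open>
  The field with its six channels gathered at every pixel. The constraints couple the channels of
  one pixel but not different pixels, so in this layout they are product sets.
\<close>

definition pixels :: "'n::finite vfield \<Rightarrow> (((complex^channel)^'n)^'n)" where
  "pixels x = (\<chi> \<xi>1 \<xi>2 c. x $ c $ \<xi>1 $ \<xi>2)"

lemma linear_pixels: "linear pixels"
  by (rule linearI) (simp_all add: pixels_def vec_eq_iff)

lemma norm_pixels: "norm (pixels x) = norm x"
proof (rule power2_eq_imp_eq)
  have "(norm (pixels x))\<^sup>2 = (\<Sum>\<xi>1\<in>UNIV. \<Sum>\<xi>2\<in>UNIV. \<Sum>c\<in>UNIV. (cmod (x $ c $ \<xi>1 $ \<xi>2))\<^sup>2)"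
    by (simp add: norm_vec_squared pixels_def)
  also have "\<dots> = (\<Sum>\<xi>1\<in>UNIV. \<Sum>c\<in>UNIV. \<Sum>\<xi>2\<in>UNIV. (cmod (x $ c $ \<xi>1 $ \<xi>2))\<^sup>2)"
    by (rule sum.cong[OF refl], rule sum.swap)
  also have "\<dots> = (norm x)\<^sup>2"
    by (subst sum.swap) (simp add: norm_vec_squared)
  finally show "(norm (pixels x))\<^sup>2 = (norm x)\<^sup>2" .
qed simp_all

lemma surj_pixels: "surj pixels"
  by (rule surjI[of _ "\<lambda>y. \<chi> c \<xi>1 \<xi>2. y $ \<xi>1 $ \<xi>2 $ c"]) (simp add: pixels_def vec_eq_iff)

text \<open>
  A norm-preserving endomorphism \<open>T\<close> is injective, hence surjective by dimension. So a set
  described by constraints on the pixels of \<open>T x\<close> is an isometric preimage of a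
  product over the pixels.
\<close>

lemma prox_regular_at_pixelwise:
  fixes T :: "'n::finite vfield \<Rightarrow> 'n vfield" and S :: "'n \<Rightarrow> 'n \<Rightarrow> (complex^channel) set"
  assumes lin: "linear T" and iso: "\<And>x. norm (T x) = norm x"
    and reg: "\<And>\<xi>1 \<xi>2. prox_regular_at (S \<xi>1 \<xi>2) (pixels (T p) $ \<xi>1 $ \<xi>2)"
  shows "prox_regular_at {x. \<forall>\<xi>1 \<xi>2. pixels (T x) $ \<xi>1 $ \<xi>2 \<in> S \<xi>1 \<xi>2} p"
proof -
  have "inj T"
    using iso by (simp add: linear_injective_0[OF lin]) (metis norm_eq_zero)
  then have "surj T" using lin linear_injective_imp_surjective by blast
  then have surj: "surj (pixels \<circ> T)" using surj_pixels by (rule comp_surj)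
  have "prox_regular_at {y. \<forall>\<xi>1. y $ \<xi>1 \<in> {y. \<forall>\<xi>2. y $ \<xi>2 \<in> S \<xi>1 \<xi>2}} ((pixels \<circ> T) p)"
    using reg by (intro prox_regular_at_vec) simp
  then have "prox_regular_at ((pixels \<circ> T) -` {y. \<forall>\<xi>1. y $ \<xi>1 \<in> {y. \<forall>\<xi>2. y $ \<xi>2 \<in> S \<xi>1 \<xi>2}}) p"
    using lin iso surj
    by (intro prox_regular_at_isometry_vimage)
      (auto intro: linear_compose linear_pixels simp: norm_pixels)
  then show ?thesis by (simp add: vimage_def)
qed

definition defocused_dft2 ::
    "(real, 'n::{finite,linorder}) array \<Rightarrow> 'n vfield \<Rightarrow> 'n vfield" where
  "defocused_dft2 \<phi> x = (\<chi> c. dft2 (x $ c * phase \<phi>))"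

lemma linear_defocused_dft2: "linear (defocused_dft2 \<phi>)"
proof (rule linearI)
  show "defocused_dft2 \<phi> (x + y) = defocused_dft2 \<phi> x + defocused_dft2 \<phi> y" for x y
    by (simp add: defocused_dft2_def vec_eq_iff[where 'b = channel] distrib_right linear_add[OF linear_dft2])
  show "defocused_dft2 \<phi> (a *\<^sub>R x) = a *\<^sub>R defocused_dft2 \<phi> x" for a x
  proof -
    have "(a *\<^sub>R x) $ c * phase \<phi> = a *\<^sub>R (x $ c * phase \<phi>)" for c
      by (simp add: vec_eq_iff)
    then show ?thesis
      by (simp add: defocused_dft2_def vec_eq_iff[where 'b = channel] linear_scale[OF linear_dft2])
  qed
qed

lemma norm_defocused_dft2: "norm (defocused_dft2 \<phi> x) = norm x"
proof -
  have "norm (x $ c * phase \<phi>) = norm (x $ c)" for c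
    by (simp add: norm_vec_def phase_def norm_mult)
  then show ?thesis
    by (simp add: norm_vec_def[where 'b = channel] defocused_dft2_def norm_dft2)
qed

text \<open>
  In the Fourier domain \<open>\<Omega>\<^sub>d\<close> prescribes the norm of each pixel's six-channel vector; a nonzero
  amplitude at \<open>p\<close> makes each of these spheres nondegenerate.
\<close>

lemma prox_regular_at_Omega:
  fixes \<phi> r :: "(real, 'n::{finite,linorder}) array"
  assumes p: "p \<in> Omega \<phi> r" and nz: "\<And>\<xi>1 \<xi>2. G_amp \<phi> p $ \<xi>1 $ \<xi>2 \<noteq> 0"
  shows "prox_regular_at (Omega \<phi> r) p"
proof -
  have int: "intensity \<phi> x $ \<xi>1 $ \<xi>2 = (norm (pixels (defocused_dft2 \<phi> x) $ \<xi>1 $ \<xi>2))\<^sup>2" for x \<xi>1 \<xi>2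
    by (simp add: intensity_def norm_vec_squared pixels_def defocused_dft2_def)
  have r: "r $ \<xi>1 $ \<xi>2 = (norm (pixels (defocused_dft2 \<phi> p) $ \<xi>1 $ \<xi>2))\<^sup>2" for \<xi>1 \<xi>2
    using p int by (auto simp: Omega_def)
  have pos: "sqrt (r $ \<xi>1 $ \<xi>2) > 0" for \<xi>1 \<xi>2
    using nz[of \<xi>1 \<xi>2] r[of \<xi>1 \<xi>2] by (simp add: G_amp_def int)
  have eq: "Omega \<phi> r = {x. \<forall>\<xi>1 \<xi>2. pixels (defocused_dft2 \<phi> x) $ \<xi>1 $ \<xi>2
      \<in> {w \<in> UNIV. norm w = sqrt (r $ \<xi>1 $ \<xi>2)}}"
    using pos by (auto simp: Omega_def vec_eq_iff[where 'b = 'n] int less_imp_le intro!: real_sqrt_unique[symmetric])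
  have "prox_regular_at {w \<in> UNIV. norm w = sqrt (r $ \<xi>1 $ \<xi>2)}
      (pixels (defocused_dft2 \<phi> p) $ \<xi>1 $ \<xi>2)" for \<xi>1 \<xi>2
    using pos by (intro prox_regular_at_subspace_Int_sphere) (auto simp: r)
  then show ?thesis
    unfolding eq by (rule prox_regular_at_pixelwise[OF linear_defocused_dft2 norm_defocused_dft2])
qed

lemma subspace_Omega0: "subspace (Omega0 E)"
proof (rule subspaceI)
  show "0 \<in> Omega0 E"
    unfolding Omega0_def by (rule CollectI, rule exI[of _ 0]) (simp add: vec_eq_iff)
next
  fix x y assume "x \<in> Omega0 E" "y \<in> Omega0 E"
  then obtain u v where "x = (\<chi> c. complex_array (E c) * u)" "y = (\<chi> c. complex_array (E c) * v)"
    by (auto simp: Omega0_def)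
  then show "x + y \<in> Omega0 E"
    unfolding Omega0_def by (intro CollectI exI[of _ "u + v"]) (simp add: vec_eq_iff distrib_left)
next
  fix a :: real and x assume "x \<in> Omega0 E"
  then obtain u where "x = (\<chi> c. complex_array (E c) * u)"
    by (auto simp: Omega0_def)
  then show "a *\<^sub>R x \<in> Omega0 E"
    unfolding Omega0_def by (intro CollectI exI[of _ "a *\<^sub>R u"]) (simp add: vec_eq_iff)
qed

text \<open>
  The complex line \<open>\<complex> e\<close>; as \<open>e\<close> is real, a point \<open>z e\<close> of it has norm \<open>\<bar>z\<bar> \<parallel>e\<parallel>\<close>.
\<close>

definition real_direction_line :: "(channel \<Rightarrow> real) \<Rightarrow> (complex^channel) set" where
  "real_direction_line e = range (\<lambda>z. \<chi> c. of_real (e c) * z)"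

lemma subspace_real_direction_line: "subspace (real_direction_line e)"
  unfolding real_direction_line_def
  by (intro linear_subspace_image linearI subspace_UNIV) (simp_all add: vec_eq_iff distrib_left)

lemma norm_real_direction:
  "norm ((\<chi> c. of_real (e c) * z) :: complex^channel) = sqrt (\<Sum>c\<in>UNIV. (e c)\<^sup>2) * cmod z"
  by (simp add: norm_vec_def L2_set_def norm_mult power_mult_distrib sum_distrib_right[symmetric]
      real_sqrt_mult)

text \<open>
  The points \<open>z E\<close> of the line with norm \<open>\<parallel>E\<parallel> A\<close> are those with \<open>\<bar>z\<bar> = A\<close>, because \<open>E \<noteq> 0\<close>; such a
  \<open>z\<close> is \<open>A e\<^sup>i\<^sup>t\<close> for some \<open>t\<close>, and the phases of the pixels can be chosen independently of
  each other.
\<close>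

lemma Chi_eq_pixelwise:
  fixes E :: "channel \<Rightarrow> (real, 'n::finite) array"
  assumes E: "\<And>\<xi>1 \<xi>2. (\<Sum>c\<in>UNIV. (E c $ \<xi>1 $ \<xi>2)\<^sup>2) > 0"
    and A: "\<And>\<xi>1 \<xi>2. A $ \<xi>1 $ \<xi>2 \<ge> 0"
  shows "Chi E A = {x. \<forall>\<xi>1 \<xi>2. pixels x $ \<xi>1 $ \<xi>2 \<in>
    {w \<in> real_direction_line (\<lambda>c. E c $ \<xi>1 $ \<xi>2).
       norm w = sqrt (\<Sum>c\<in>UNIV. (E c $ \<xi>1 $ \<xi>2)\<^sup>2) * A $ \<xi>1 $ \<xi>2}}"
    (is "_ = ?R")
proof (intro set_eqI iffI)
  fix x assume "x \<in> Chi E A"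
  then obtain \<Phi> where x: "x = (\<chi> c. complex_array (E c) * complex_array A * phase \<Phi>)"
    by (auto simp: Chi_def)
  have px: "pixels x $ \<xi>1 $ \<xi>2 = (\<chi> c. of_real (E c $ \<xi>1 $ \<xi>2) *
      (of_real (A $ \<xi>1 $ \<xi>2) * exp (\<i> * of_real (\<Phi> $ \<xi>1 $ \<xi>2))))" for \<xi>1 \<xi>2
    by (simp add: x pixels_def complex_array_def phase_def vec_eq_iff)
  show "x \<in> ?R"
    using A by (auto simp: px norm_real_direction norm_mult real_direction_line_def)
next
  fix x assume x: "x \<in> ?R"
  have "\<forall>\<xi>1 \<xi>2. \<exists>t. pixels x $ \<xi>1 $ \<xi>2 =
      (\<chi> c. of_real (E c $ \<xi>1 $ \<xi>2) * (of_real (A $ \<xi>1 $ \<xi>2) * exp (\<i> * of_real t)))"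
  proof (intro allI)
    fix \<xi>1 \<xi>2
    obtain z where z: "pixels x $ \<xi>1 $ \<xi>2 = (\<chi> c. of_real (E c $ \<xi>1 $ \<xi>2) * z)"
      using x by (auto simp: real_direction_line_def)
    have "norm (pixels x $ \<xi>1 $ \<xi>2) = sqrt (\<Sum>c\<in>UNIV. (E c $ \<xi>1 $ \<xi>2)\<^sup>2) * A $ \<xi>1 $ \<xi>2"
      using x by simp
    then have "cmod z = A $ \<xi>1 $ \<xi>2"
      using E[of \<xi>1 \<xi>2] by (simp add: z norm_real_direction)
    then have "z = of_real (A $ \<xi>1 $ \<xi>2) * exp (\<i> * of_real (Arg z))"
      by (metis Arg_eq mult_zero_left norm_eq_zero of_real_0)
    with z show "\<exists>t. pixels x $ \<xi>1 $ \<xi>2 =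
        (\<chi> c. of_real (E c $ \<xi>1 $ \<xi>2) * (of_real (A $ \<xi>1 $ \<xi>2) * exp (\<i> * of_real t)))"
      by metis
  qed
  then obtain t where t: "\<And>\<xi>1 \<xi>2. pixels x $ \<xi>1 $ \<xi>2 =
      (\<chi> c. of_real (E c $ \<xi>1 $ \<xi>2) * (of_real (A $ \<xi>1 $ \<xi>2) * exp (\<i> * of_real (t \<xi>1 \<xi>2))))"
    by metis
  have "x = (\<chi> c. complex_array (E c) * complex_array A * phase (\<chi> \<xi>1 \<xi>2. t \<xi>1 \<xi>2))"
    using t by (simp add: vec_eq_iff pixels_def complex_array_def phase_def mult.assoc)
  then show "x \<in> Chi E A" by (auto simp: Chi_def)
qed

lemma prox_regular_at_Chi:
  fixes E :: "channel \<Rightarrow> (real, 'n::finite) array"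
  assumes E: "\<And>\<xi>1 \<xi>2. (\<Sum>c\<in>UNIV. (E c $ \<xi>1 $ \<xi>2)\<^sup>2) > 0"
    and A: "\<And>\<xi>1 \<xi>2. A $ \<xi>1 $ \<xi>2 > 0" and p: "p \<in> Chi E A"
  shows "prox_regular_at (Chi E A) p"
proof -
  let ?\<rho> = "\<lambda>\<xi>1 \<xi>2. sqrt (\<Sum>c\<in>UNIV. (E c $ \<xi>1 $ \<xi>2)\<^sup>2) * A $ \<xi>1 $ \<xi>2"
  let ?S = "\<lambda>\<xi>1 \<xi>2. {w \<in> real_direction_line (\<lambda>c. E c $ \<xi>1 $ \<xi>2). norm w = ?\<rho> \<xi>1 \<xi>2}"
  have eq: "Chi E A = {x. \<forall>\<xi>1 \<xi>2. pixels (id x) $ \<xi>1 $ \<xi>2 \<in> ?S \<xi>1 \<xi>2}"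
    using Chi_eq_pixelwise[of E A] E A by (simp add: less_imp_le)
  have "prox_regular_at (?S \<xi>1 \<xi>2) (pixels (id p) $ \<xi>1 $ \<xi>2)" for \<xi>1 \<xi>2
    using p E A unfolding eq
    by (intro prox_regular_at_subspace_Int_sphere subspace_real_direction_line) auto
  then show ?thesis
    unfolding eq by (intro prox_regular_at_pixelwise linear_id) auto
qed

lemma prox_regular_at_prod_Omega:
  assumes "p \<in> prod_Omega \<phi> r" and "\<And>d \<xi>1 \<xi>2. G_amp (\<phi> d) (p $ d) $ \<xi>1 $ \<xi>2 \<noteq> 0"
  shows "prox_regular_at (prod_Omega \<phi> r) p"
  using assms unfolding prod_Omega_def
  by (intro prox_regular_at_vec prox_regular_at_Omega) auto

theorem proposition5p8:
  fixes kX kY kZ :: "(real, 'n::{finite,linorder}) array"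
    and \<phi> r :: "'m::finite \<Rightarrow> (real, 'n) array"
    and A :: "(real, 'n) array"
  assumes unit: "\<And>\<xi>1 \<xi>2. (kX $ \<xi>1 $ \<xi>2)\<^sup>2 + (kY $ \<xi>1 $ \<xi>2)\<^sup>2 + (kZ $ \<xi>1 $ \<xi>2)\<^sup>2 = 1"
    and kZ: "\<And>\<xi>1 \<xi>2. 1 + kZ $ \<xi>1 $ \<xi>2 \<noteq> 0"
    and r: "\<And>d \<xi>1 \<xi>2. r d $ \<xi>1 $ \<xi>2 \<ge> 0"
    and A: "\<And>\<xi>1 \<xi>2. A $ \<xi>1 $ \<xi>2 \<ge> 0"
  shows
    "(\<forall>p \<in> prod_Omega \<phi> r.
        (\<forall>d \<xi>1 \<xi>2. G_amp (\<phi> d) (p $ d) $ \<xi>1 $ \<xi>2 \<noteq> 0) \<longrightarrow>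
        prox_regular_at (prod_Omega \<phi> r) p) \<and>
     (\<forall>(p0, p) \<in> Omega0 (lensE kX kY kZ) \<times> prod_Omega \<phi> r.
        (\<forall>d \<xi>1 \<xi>2. G_amp (\<phi> d) (p $ d) $ \<xi>1 $ \<xi>2 \<noteq> 0) \<longrightarrow>
        prox_regular_at (Omega0 (lensE kX kY kZ) \<times> prod_Omega \<phi> r) (p0, p)) \<and>
     ((\<forall>\<xi>1 \<xi>2. A $ \<xi>1 $ \<xi>2 \<noteq> 0) \<longrightarrow>
      (\<forall>(p0, p) \<in> Chi (lensE kX kY kZ) A \<times> prod_Omega \<phi> r.
        (\<forall>d \<xi>1 \<xi>2. G_amp (\<phi> d) (p $ d) $ \<xi>1 $ \<xi>2 \<noteq> 0) \<longrightarrow>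
        prox_regular_at (Chi (lensE kX kY kZ) A \<times> prod_Omega \<phi> r) (p0, p)))"
proof (intro conjI impI ballI; clarify?)
  fix p assume "p \<in> prod_Omega \<phi> r" "\<forall>d \<xi>1 \<xi>2. G_amp (\<phi> d) (p $ d) $ \<xi>1 $ \<xi>2 \<noteq> 0"
  then show "prox_regular_at (prod_Omega \<phi> r) p"
    by (intro prox_regular_at_prod_Omega) auto
next
  fix p0 p assume "p0 \<in> Omega0 (lensE kX kY kZ)" "p \<in> prod_Omega \<phi> r"
    "\<forall>d \<xi>1 \<xi>2. G_amp (\<phi> d) (p $ d) $ \<xi>1 $ \<xi>2 \<noteq> 0"
  then show "prox_regular_at (Omega0 (lensE kX kY kZ) \<times> prod_Omega \<phi> r) (p0, p)"
    by (intro prox_regular_at_Times prox_regular_at_prod_Omega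
        prox_regular_at_subspace[OF subspace_Omega0]) auto
next
  fix p0 p assume "\<forall>\<xi>1 \<xi>2. A $ \<xi>1 $ \<xi>2 \<noteq> 0" and p: "p0 \<in> Chi (lensE kX kY kZ) A"
    "p \<in> prod_Omega \<phi> r" "\<forall>d \<xi>1 \<xi>2. G_amp (\<phi> d) (p $ d) $ \<xi>1 $ \<xi>2 \<noteq> 0"
  then have "A $ \<xi>1 $ \<xi>2 > 0" for \<xi>1 \<xi>2
    using A[of \<xi>1 \<xi>2] by (simp add: order_less_le)
  \<comment> \<open>the unit length of the wave vector keeps the direction \<open>(E\<^sub>c)\<^sub>c\<close> away from zero\<close>
  moreover have "(\<Sum>c\<in>UNIV. (lensE kX kY kZ c $ \<xi>1 $ \<xi>2)\<^sup>2) > 0" for \<xi>1 \<xi>2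
    using sum_lensE_squared[OF unit kZ] by simp
  ultimately show "prox_regular_at (Chi (lensE kX kY kZ) A \<times> prod_Omega \<phi> r) (p0, p)"
    using p by (intro prox_regular_at_Times prox_regular_at_prod_Omega prox_regular_at_Chi) auto
qed

end
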